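(* Let $\Psi:(0,1)\to\mathbb{C}^{d+1}$ be a continuous function and $t_0\in(0,1)$. Suppose that 1. $\Psi^*(t)\neq 0$ for all $t\in\mathbf{hal}(t_0)\setminus\{t_0\}$; 2. there exists $L\in\mathbb{C}^{d+1}\setminus\{0\}$ such that $$L\simeq\frac{\Psi^*(t_0+\Delta t)}{\|\Psi^*(t_0+\Delta t)\|}\simeq\frac{\Psi^*(t_0+\Delta t')}{\|\Psi^*(t_0+\Delta t')\|}\qquad\text{for all }\Delta t,\Delta t'\in\mathbb{I}_{\mathbb{R}}\setminus\{0\}.$$ Then there exist a real $\epsilon>0$ and a continuous function $\Theta:B_\epsilon(t_0)\to\mathbb{C}^{d+1}\setminus\{0\}$ such that $[\Psi(t)]=[\Theta(t)]$ in $\mathbb{C}\mathbb{P}^d$ for all $t\in B_\epsilon(t_0)\setminus\{t_0\}$. That is, $[\Theta]$ is a $C^0$-continuation of $[\Psi]$ at $t_0$.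
   Context: $\mathbb{R}^*$ and $\mathbb{C}^*=\mathbb{R}^*+\mathrm{i}\mathbb{R}^*$ are the hyperreal and hypercomplex numbers (a non-standard extension satisfying the transfer principle and containing non-zero infinitesimals, e.g. an ultrapower over a non-principal ultrafilter on $\mathbb{N}$). For a function $f$ on a set $D$, $f^*$ denotes its extension to the enlargement $D^*$. $\mathbb{I}_{\mathbb{R}}$ is the set of hyperreal $\epsilon$ with $|\epsilon|<r$ for all real $r>0$. For vectors over $\mathbb{C}^*$, $x\simeq y$ means that each component of $x-y$ is infinitesimal. $\mathbf{hal}(t_0)=\{t\in\mathbb{R}^*: t-t_0\in\mathbb{I}_{\mathbb{R}}\}$. $\|\cdot\|$ is the Euclidean norm (and its extension). $B_\epsilon(t_0)\subset(0,1)$ is the open interval of radius $\epsilon$ around $t_0$. For $x\in\mathbb{C}^{d+1}\setminus\{0\}$, $[x]\in\mathbb{C}\mathbb{P}^d$ is its class. A $C^0$-continuation of $[\Psi]$ at $t_0$ is a continuous $\mathbb{C}\mathbb{P}^d$-valued function defined also at $t_0$ which agrees with $[\Psi]$ near $t_0$ away from $t_0$. *)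

theory Defs
  imports "HOL-Analysis.Analysis"
begin

text \<open>First-order formulas over the full structure on the reals: every set of real tuples (tuples
  are lists) serves as its own relation symbol. Free and bound variables are natural numbers.\<close>

datatype formula =
    Equal nat nat
  | Holds "real list set" "nat list"
  | Neg formula
  | Conj formula formula
  | All nat formula

primrec sat :: "(real list set \<Rightarrow> 'm list set) \<Rightarrow> formula \<Rightarrow> (nat \<Rightarrow> 'm) \<Rightarrow> bool" where
  "sat I (Equal m n) e \<longleftrightarrow> e m = e n"
| "sat I (Holds R ns) e \<longleftrightarrow> map e ns \<in> I R"
| "sat I (Neg \<phi>) e \<longleftrightarrow> \<not> sat I \<phi> e"
| "sat I (Conj \<phi> \<psi>) e \<longleftrightarrow> sat I \<phi> e \<and> sat I \<psi> e"
| "sat I (All n \<phi>) e \<longleftrightarrow> (\<forall>x. sat I \<phi> (e(n := x)))"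

definition infinitesimal :: "(real \<Rightarrow> 'h::linordered_field) \<Rightarrow> 'h \<Rightarrow> bool" where
  "infinitesimal emb x \<longleftrightarrow> (\<forall>r>0. \<bar>x\<bar> < emb r)"

text \<open>The type \<^typ>\<open>'h\<close> is the field of hyperreals, \<open>emb\<close> the embedding of the reals,
  and \<open>star R\<close> the enlargement of the relation \<open>R\<close>. The axioms \<open>star_add\<close>, \<open>star_mult\<close> and
  \<open>star_less\<close> only say that the ordered field operations of \<^typ>\<open>'h\<close> are the extensions
  of the real ones. Ultrapowers of the reals over a non-principal ultrafilter on the naturals are
  instances, by Los's theorem.\<close>

locale nonstandard_extension =
  fixes emb :: "real \<Rightarrow> 'h::linordered_field"
    and star :: "real list set \<Rightarrow> 'h list set"
  assumes transfer: "sat (\<lambda>R. R) \<phi> e \<longleftrightarrow> sat star \<phi> (\<lambda>n. emb (e n))"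
    and star_add: "[x, y, z] \<in> star {[a, b, c] | a b c. a + b = c} \<longleftrightarrow> x + y = z"
    and star_mult: "[x, y, z] \<in> star {[a, b, c] | a b c. a * b = c} \<longleftrightarrow> x * y = z"
    and star_less: "[x, y] \<in> star {[a, b] | a b. a < b} \<longleftrightarrow> x < y"
    and nonzero_infinitesimal: "\<exists>x. x \<noteq> 0 \<and> infinitesimal emb x"

definition hal :: "(real \<Rightarrow> 'h::linordered_field) \<Rightarrow> real \<Rightarrow> 'h set" where
  "hal emb t0 = {t. infinitesimal emb (t - emb t0)}"

text \<open>The extension of \<open>f : D \<rightarrow> \<real>\<close> to the enlargement of \<open>D\<close>, obtained by enlarging the graph
  of \<open>f\<close>. It is meaningful at points of the enlargement of \<open>D\<close>, where the value is unique
  by transfer.\<close>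

definition star_fun ::
  "(real list set \<Rightarrow> 'h list set) \<Rightarrow> real set \<Rightarrow> (real \<Rightarrow> real) \<Rightarrow> 'h \<Rightarrow> 'h" where
  "star_fun star D f x = (THE y. [x, y] \<in> star {[a, f a] | a. a \<in> D})"

datatype 'h hcomplex = HComplex (hRe: 'h) (hIm: 'h)

instantiation hcomplex :: (zero) zero
begin
definition "0 = HComplex 0 0"
instance ..
end

instantiation hcomplex :: (minus) minus
begin
definition "z - w = HComplex (hRe z - hRe w) (hIm z - hIm w)"
instance ..
end

definition hmod :: "(real list set \<Rightarrow> 'h::linordered_field list set) \<Rightarrow> 'h hcomplex \<Rightarrow> 'h" where
  "hmod star z = star_fun star {0..} sqrt ((hRe z)\<^sup>2 + (hIm z)\<^sup>2)"

text \<open>By transfer, this is the extension of the Euclidean norm of complex vectors.\<close>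

definition hnorm ::
  "(real list set \<Rightarrow> 'h::linordered_field list set) \<Rightarrow> 'h hcomplex ^ 'n \<Rightarrow> 'h" where
  "hnorm star v = star_fun star {0..} sqrt (\<Sum>i\<in>UNIV. (hRe (v $ i))\<^sup>2 + (hIm (v $ i))\<^sup>2)"

definition hdivide :: "'h::linordered_field hcomplex ^ 'n \<Rightarrow> 'h \<Rightarrow> 'h hcomplex ^ 'n" where
  "hdivide v r = (\<chi> i. HComplex (hRe (v $ i) / r) (hIm (v $ i) / r))"

definition hvec :: "(real \<Rightarrow> 'h) \<Rightarrow> complex ^ 'n \<Rightarrow> 'h hcomplex ^ 'n" where
  "hvec emb v = (\<chi> i. HComplex (emb (Re (v $ i))) (emb (Im (v $ i))))"

definition star_vfun ::
  "(real list set \<Rightarrow> 'h list set) \<Rightarrow> real set \<Rightarrow> (real \<Rightarrow> complex ^ 'n) \<Rightarrow> 'h \<Rightarrow> 'h hcomplex ^ 'n" where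
  "star_vfun star D F x =
     (\<chi> i. HComplex (star_fun star D (\<lambda>t. Re (F t $ i)) x) (star_fun star D (\<lambda>t. Im (F t $ i)) x))"

definition infinitely_close ::
  "(real \<Rightarrow> 'h::linordered_field) \<Rightarrow> (real list set \<Rightarrow> 'h list set) \<Rightarrow>
   'h hcomplex ^ 'n \<Rightarrow> 'h hcomplex ^ 'n \<Rightarrow> bool" where
  "infinitely_close emb star x y \<longleftrightarrow> (\<forall>i. infinitesimal emb (hmod star ((x - y) $ i)))"

text \<open>The class of \<open>x\<close> is its punctured complex line. The space of all classes of non-zero
  vectors carries the quotient topology. With \<open>CARD('n) = d + 1\<close> it is the \<open>d\<close>-dimensional
  complex projective space.\<close>

definition proj_class :: "complex ^ 'n \<Rightarrow> (complex ^ 'n) set" where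
  "proj_class x = {c *s x | c. c \<noteq> 0}"

definition CP_topology :: "(complex ^ 'n) set topology" where
  "CP_topology = topology (\<lambda>U. U \<subseteq> proj_class ` (- {0}) \<and> open {x. x \<noteq> 0 \<and> proj_class x \<in> U})"

lemma openin_CP_topology:
  "openin CP_topology U \<longleftrightarrow>
     U \<subseteq> proj_class ` (- {0}) \<and> open {x :: complex ^ 'n. x \<noteq> 0 \<and> proj_class x \<in> U}"
proof -
  have "istopology (\<lambda>U. U \<subseteq> proj_class ` (- {0}) \<and>
      open {x :: complex ^ 'n. x \<noteq> 0 \<and> proj_class x \<in> U})"
    unfolding istopology_def
  proof (intro conjI allI impI; (elim conjE)?)
    fix S T :: "(complex ^ 'n) set set"
    assume *: "S \<subseteq> proj_class ` (- {0})" "open {x. x \<noteq> 0 \<and> proj_class x \<in> S}"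
      "T \<subseteq> proj_class ` (- {0})" "open {x. x \<noteq> 0 \<and> proj_class x \<in> T}"
    show "S \<inter> T \<subseteq> proj_class ` (- {0})" using * by blast
    have "{x. x \<noteq> 0 \<and> proj_class x \<in> S \<inter> T} =
        {x. x \<noteq> 0 \<and> proj_class x \<in> S} \<inter> {x. x \<noteq> 0 \<and> proj_class x \<in> T}" by auto
    then show "open {x. x \<noteq> 0 \<and> proj_class x \<in> S \<inter> T}" using * by (simp add: open_Int)
  next
    fix K :: "(complex ^ 'n) set set set"
    assume *: "\<forall>U\<in>K. U \<subseteq> proj_class ` (- {0}) \<and> open {x. x \<noteq> 0 \<and> proj_class x \<in> U}"
    show "\<Union>K \<subseteq> proj_class ` (- {0})" using * by blast
    have "{x. x \<noteq> 0 \<and> proj_class x \<in> \<Union>K} = (\<Union>U\<in>K. {x. x \<noteq> 0 \<and> proj_class x \<in> U})" by auto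
    then show "open {x. x \<noteq> 0 \<and> proj_class x \<in> \<Union>K}" using * by auto
  qed
  then show ?thesis
    unfolding CP_topology_def by (simp add: topology_inverse')
qed

text \<open>\<open>G\<close>, defined on the neighbourhood \<open>S\<close> of \<open>t0\<close>, is a continuation of \<open>F\<close> at \<open>t0\<close>.\<close>

definition C0_continuation ::
  "real set \<Rightarrow> (real \<Rightarrow> (complex ^ 'n) set) \<Rightarrow> (real \<Rightarrow> (complex ^ 'n) set) \<Rightarrow> real \<Rightarrow> bool" where
  "C0_continuation S G F t0 \<longleftrightarrow>
     open S \<and> t0 \<in> S \<and> continuous_map (top_of_set S) CP_topology G \<and>
     (\<forall>\<^sub>F t in at t0. F t = G t)"

end

theory Submission
  imports Defs
begin

text \<open>For fixed \<open>t\<close> in the enlargement of \<open>D\<close>, the map \<open>f \<mapsto> f\<^sup>*(t)\<close> respects all field operations,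
  composition and strict inequalities, so the second hypothesis says that the extension of
  \<open>|L\<^sub>i - \<Psi>\<^sub>i(t)/\<parallel>\<Psi>(t)\<parallel>|\<close> is infinitesimal on the punctured halo of \<open>t0\<close>. If this real function did
  not tend to \<open>0\<close> at \<open>t0\<close>, a choice function \<open>\<tau>(\<delta>)\<close> of bad points at distance less than \<open>\<delta>\<close> from \<open>t0\<close>
  would, extended to an infinitesimal \<open>\<delta>\<close>, produce a bad point in the halo. Hence \<open>\<Psi>/\<parallel>\<Psi>\<parallel>\<close> tends to
  \<open>L \<noteq> 0\<close>, and setting it to \<open>L\<close> at \<open>t0\<close> gives \<open>\<Theta>\<close>.\<close>

section \<open>Quantifier blocks and finite conjunctions of formulas\<close>

lemma sat_foldr_All:
  "sat I (foldr All ns \<phi>) e \<longleftrightarrow> (\<forall>e'. (\<forall>k. k \<notin> set ns \<longrightarrow> e' k = e k) \<longrightarrow> sat I \<phi> e')"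
proof (induction ns arbitrary: e)
  case Nil
  show ?case by (simp flip: fun_eq_iff)
next
  case (Cons n ns)
  have "(\<forall>x e'. (\<forall>k. k \<notin> set ns \<longrightarrow> e' k = (e(n := x)) k) \<longrightarrow> sat I \<phi> e') \<longleftrightarrow>
      (\<forall>e'. (\<forall>k. k \<notin> set (n # ns) \<longrightarrow> e' k = e k) \<longrightarrow> sat I \<phi> e')" (is "?L \<longleftrightarrow> ?R")
  proof
    assume ?L
    show ?R
    proof (intro allI impI)
      fix e' assume "\<forall>k. k \<notin> set (n # ns) \<longrightarrow> e' k = e k"
      \<comment> \<open>The outermost quantifier is instantiated with the value that
        \<open>e'\<close> itself gives to \<open>n\<close>.\<close>
      then have "\<forall>k. k \<notin> set ns \<longrightarrow> e' k = (e(n := e' n)) k" by auto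
      then show "sat I \<phi> e'" by (rule \<open>?L\<close>[THEN spec, THEN spec, THEN mp])
    qed
  next
    assume ?R
    show ?L
    proof (intro allI impI)
      fix x e' assume "\<forall>k. k \<notin> set ns \<longrightarrow> e' k = (e(n := x)) k"
      then have "\<forall>k. k \<notin> set (n # ns) \<longrightarrow> e' k = e k" by auto
      then show "sat I \<phi> e'" by (rule \<open>?R\<close>[THEN spec, THEN mp])
    qed
  qed
  then show ?case by (simp add: Cons)
qed

lemma sat_foldr_Conj:
  "sat I (foldr Conj \<phi>s \<psi>) e \<longleftrightarrow> (\<forall>\<phi>\<in>set \<phi>s. sat I \<phi> e) \<and> sat I \<psi> e"
  by (induction \<phi>s) auto

section \<open>Transfer for universally quantified formulas\<close>

context nonstandard_extension
begin

text \<open>The axiom \<open>transfer\<close> evaluates formulas only at embedded reals. Closing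
  over the variables in \<open>ns\<close> before transferring lets these take arbitrary hyperreal
  values afterwards; all other variables must stay standard, with real values given by
  \<open>r\<close>.\<close>

lemma transfer_universal:
  assumes "\<And>e. sat (\<lambda>R. R) \<phi> e" and "\<And>k. k \<notin> set ns \<Longrightarrow> e k = emb (r k)"
  shows "sat star \<phi> e"
proof -
  have "sat (\<lambda>R. R) (foldr All ns \<phi>) r" unfolding sat_foldr_All using assms(1) by blast
  then have "sat star (foldr All ns \<phi>) (\<lambda>n. emb (r n))" by (rule transfer[THEN iffD1])
  then show ?thesis unfolding sat_foldr_All using assms(2) by blast
qed

lemma emb_in_star: "map emb xs \<in> star R \<longleftrightarrow> xs \<in> R"
proof -
  have "map (\<lambda>n. emb (xs ! n)) [0..<length xs] = map emb xs"
    by (rule nth_equalityI) simp_all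
  then show ?thesis
    using transfer[of "Holds R [0..<length xs]" "\<lambda>n. xs ! n"] unfolding sat.simps map_nth by simp
qed

lemma emb_add: "emb (a + b) = emb a + emb b"
proof -
  have "map emb [a, b, a + b] \<in> star {[a, b, c] | a b c. a + b = c}"
    unfolding emb_in_star by simp
  then show ?thesis unfolding list.map star_add by simp
qed

lemma emb_0: "emb 0 = 0"
  using emb_add[of 0 0] by simp

section \<open>Extensions of real functions\<close>

abbreviation enlarge :: "real set \<Rightarrow> 'h set" where
  "enlarge D \<equiv> {x. [x] \<in> star {[a] | a. a \<in> D}}"

abbreviation graph :: "real set \<Rightarrow> (real \<Rightarrow> real) \<Rightarrow> real list set" where
  "graph D f \<equiv> {[a, f a] | a. a \<in> D}"

lemma star_graph_unique:
  assumes "[x, y] \<in> star (graph D f)" "[x, z] \<in> star (graph D f)"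
  shows "y = z"
proof -
  \<comment> \<open>Uniqueness of values is an implication, spelled with \<open>Neg\<close> and
    \<open>Conj\<close>. Variables 0, 1, 2 hold \<open>x\<close>, \<open>y\<close>,
    \<open>z\<close>; the default \<open>emb 0\<close> keeps the remaining variables
    standard.\<close>
  have "sat star (Neg (Conj (Holds (graph D f) [0, 1])
      (Conj (Holds (graph D f) [0, 2]) (Neg (Equal 1 2))))) ((\<lambda>_. emb 0)(0 := x, 1 := y, 2 := z))"
    by (rule transfer_universal[where ns = "[0, 1, 2]" and r = "\<lambda>_. 0"]) auto
  then show ?thesis using assms by simp
qed

lemma star_fun_eqI:
  assumes "[x, y] \<in> star (graph D f)"
  shows "star_fun star D f x = y"
  unfolding star_fun_def using assms by (rule the_equality) (rule star_graph_unique[OF _ assms])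

lemma star_fun_graph:
  assumes "x \<in> enlarge D"
  shows "[x, star_fun star D f x] \<in> star (graph D f)"
proof -
  \<comment> \<open>Totality of the graph over \<open>D\<close>: the existential quantifier is the
    negation of \<open>All\<close> before a negation.\<close>
  have "sat star (Neg (Conj (Holds {[a] | a. a \<in> D} [0]) (All 1 (Neg (Holds (graph D f) [0, 1])))))
      ((\<lambda>_. emb 0)(0 := x))"
    by (rule transfer_universal[where ns = "[0]" and r = "\<lambda>_. 0"]) auto
  then obtain y where "[x, y] \<in> star (graph D f)" using assms by auto
  then show ?thesis by (simp only: star_fun_eqI)
qed

text \<open>One transfer covers every pointwise relation between finitely many functions on
  \<open>D\<close>. Order, sums, products and composition follow by taking for \<open>R\<close> the
  order relation or the graph of the operation.\<close>

lemma star_fun_rel: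
  assumes x: "x \<in> enlarge D" and R: "\<And>a. a \<in> D \<Longrightarrow> map (\<lambda>f. f a) fs \<in> R"
  shows "map (\<lambda>f. star_fun star D f x) fs \<in> star R"
proof -
  define n where "n = length fs"
  \<comment> \<open>Variable \<open>n\<close> holds the argument and each variable
    \<open>i < n\<close> the value of \<open>fs ! i\<close> there, so \<open>[0..<n]\<close> is
    exactly the tuple to be tested against \<open>R\<close>. The formula below says that all of
    \<open>hs\<close> imply this membership.\<close>
  define hs where "hs = Holds {[a] | a. a \<in> D} [n] # map (\<lambda>i. Holds (graph D (fs ! i)) [n, i]) [0..<n]"
  define e where "e = (\<lambda>i. if i < n then star_fun star D (fs ! i) x else if i = n then x else emb 0)"
  have "sat star (Neg (foldr Conj hs (Neg (Holds R [0..<n])))) e"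
  proof (rule transfer_universal)
    fix e
    have "map e [0..<n] \<in> R" if "\<forall>\<phi>\<in>set hs. sat (\<lambda>R. R) \<phi> e"
    proof -
      have "e n \<in> D" using that by (simp add: hs_def)
      have "e i = (fs ! i) (e n)" if "i < n" for i
      proof -
        have "sat (\<lambda>R. R) (Holds (graph D (fs ! i)) [n, i]) e"
          using \<open>\<forall>\<phi>\<in>set hs. sat (\<lambda>R. R) \<phi> e\<close> that unfolding hs_def by simp
        then show ?thesis by simp
      qed
      then have "map e [0..<n] = map (\<lambda>f. f (e n)) fs"
        by (intro nth_equalityI) (simp_all add: n_def)
      then show ?thesis using R[OF \<open>e n \<in> D\<close>] by simp
    qed
    then show "sat (\<lambda>R. R) (Neg (foldr Conj hs (Neg (Holds R [0..<n])))) e"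
      unfolding sat.simps sat_foldr_Conj by blast
  next
    fix k assume "k \<notin> set [0..<Suc n]"
    then show "e k = emb ((\<lambda>_. 0) k)" by (simp add: e_def)
  qed
  moreover have "\<forall>\<phi>\<in>set hs. sat star \<phi> e"
    using x star_fun_graph[OF x] unfolding hs_def by (simp add: e_def)
  ultimately have "map e [0..<n] \<in> star R" unfolding sat.simps sat_foldr_Conj by blast
  moreover have "map e [0..<n] = map (\<lambda>f. star_fun star D f x) fs"
    by (intro nth_equalityI) (simp_all add: n_def e_def)
  ultimately show ?thesis by simp
qed

lemma star_fun_less:
  assumes "x \<in> enlarge D" "\<And>a. a \<in> D \<Longrightarrow> f a < g a"
  shows "star_fun star D f x < star_fun star D g x"
  using star_fun_rel[OF assms(1), of "[f, g]" "{[a, b] | a b. a < b}"] assms(2)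
  by (simp add: star_less)

lemma star_fun_comp:
  assumes "x \<in> enlarge D" "\<And>a. a \<in> D \<Longrightarrow> f a \<in> E"
  shows "star_fun star E g (star_fun star D f x) = star_fun star D (\<lambda>a. g (f a)) x"
  using star_fun_rel[OF assms(1), of "[f, \<lambda>a. g (f a)]" "graph E g"] assms(2)
  by (auto intro: star_fun_eqI)

lemma star_fun_const:
  assumes "x \<in> enlarge D"
  shows "star_fun star D (\<lambda>_. c) x = emb c"
proof (rule star_fun_eqI)
  \<comment> \<open>The singleton relation \<open>{[c]}\<close> names the constant: it pins variable
    1 to \<open>c\<close> in the reals, and its enlargement contains \<open>[emb c]\<close>.\<close>
  have "sat star (Neg (Conj (Holds {[a] | a. a \<in> D} [0])
      (Conj (Holds {[c]} [1]) (Neg (Holds (graph D (\<lambda>_. c)) [0, 1])))))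
      ((\<lambda>_. emb 0)(0 := x, 1 := emb c))"
    by (rule transfer_universal[where ns = "[0, 1]" and r = "\<lambda>_. 0"]) auto
  then show "[x, emb c] \<in> star (graph D (\<lambda>_. c))"
    using assms emb_in_star[of "[c]" "{[c]}"] by simp
qed

lemma star_fun_ident:
  assumes "x \<in> enlarge D"
  shows "star_fun star D (\<lambda>a. a) x = x"
proof (rule star_fun_eqI)
  have "sat star (Neg (Conj (Holds {[a] | a. a \<in> D} [0]) (Neg (Holds (graph D (\<lambda>a. a)) [0, 0]))))
      ((\<lambda>_. emb 0)(0 := x))"
    by (rule transfer_universal[where ns = "[0]" and r = "\<lambda>_. 0"]) auto
  then show "[x, x] \<in> star (graph D (\<lambda>a. a))" using assms by simp
qed

section \<open>Field operations on extended functions\<close>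

lemma star_fun_add:
  assumes "x \<in> enlarge D"
  shows "star_fun star D (\<lambda>a. f a + g a) x = star_fun star D f x + star_fun star D g x"
proof -
  have "map (\<lambda>h. star_fun star D h x) [f, g, \<lambda>a. f a + g a]
      \<in> star {[a, b, c] | a b c. a + b = c}"
    by (rule star_fun_rel[OF assms]) simp
  then show ?thesis unfolding list.map star_add by simp
qed

lemma star_fun_mult:
  assumes "x \<in> enlarge D"
  shows "star_fun star D (\<lambda>a. f a * g a) x = star_fun star D f x * star_fun star D g x"
proof -
  have "map (\<lambda>h. star_fun star D h x) [f, g, \<lambda>a. f a * g a]
      \<in> star {[a, b, c] | a b c. a * b = c}"
    by (rule star_fun_rel[OF assms]) simp
  then show ?thesis unfolding list.map star_mult by simp
qed

lemma star_fun_diff: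
  assumes "x \<in> enlarge D"
  shows "star_fun star D (\<lambda>a. f a - g a) x = star_fun star D f x - star_fun star D g x"
  using star_fun_add[OF assms, of "\<lambda>a. f a - g a" g] by simp

lemma star_fun_inverse:
  assumes x: "x \<in> enlarge D"
  shows "star_fun star D (\<lambda>a. inverse (f a)) x = inverse (star_fun star D f x)"
proof -
  let ?f = "star_fun star D f x" and ?k = "star_fun star D (\<lambda>a. inverse (f a)) x"
  \<comment> \<open>These two identities determine the inverse in any field, including
    \<open>inverse 0 = 0\<close>, so zeros of \<open>f\<close> need no exception.\<close>
  have r: "r * inverse r * r = r" "inverse r * r * inverse r = inverse r" for r :: real
    by (cases "r = 0"; simp)+
  have "?f * ?k * ?f = ?f" "?k * ?f * ?k = ?k"
    by (simp_all add: star_fun_mult[OF x, symmetric] r)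
  then show ?thesis
    by (cases "?f = 0") (auto simp: field_simps)
qed

lemma star_fun_divide:
  assumes "x \<in> enlarge D"
  shows "star_fun star D (\<lambda>a. f a / g a) x = star_fun star D f x / star_fun star D g x"
  by (simp add: divide_inverse star_fun_mult[OF assms] star_fun_inverse[OF assms])

lemma star_fun_power2:
  assumes "x \<in> enlarge D"
  shows "star_fun star D (\<lambda>a. (f a)\<^sup>2) x = (star_fun star D f x)\<^sup>2"
  by (simp add: power2_eq_square star_fun_mult[OF assms])

lemma star_fun_sum:
  assumes x: "x \<in> enlarge D"
  shows "star_fun star D (\<lambda>a. \<Sum>i\<in>S. f i a) x = (\<Sum>i\<in>S. star_fun star D (f i) x)"
proof (induction S rule: infinite_finite_induct)
  case (insert i S)
  then show ?case by (simp add: star_fun_add[OF x])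
qed (simp_all add: star_fun_const[OF x] emb_0)

section \<open>Hypercomplex modulus and Euclidean norm\<close>

lemma hmod_star_fun:
  assumes x: "x \<in> enlarge D"
  shows "hmod star (HComplex (star_fun star D (\<lambda>t. Re (h t)) x) (star_fun star D (\<lambda>t. Im (h t)) x))
    = star_fun star D (\<lambda>t. cmod (h t)) x"
  \<comment> \<open>The reversed rules gather the squares and their sum into the extension of one
    real function; its values lie in \<open>{0..}\<close>, so it composes with
    \<open>sqrt\<close>.\<close>
  by (simp add: hmod_def cmod_def star_fun_comp[OF x]
      flip: star_fun_power2[OF x] star_fun_add[OF x])

lemma hnorm_star_vfun:
  assumes x: "x \<in> enlarge D"
  shows "hnorm star (star_vfun star D F x) = star_fun star D (\<lambda>t. norm (F t)) x"
proof -
  have n: "norm v = sqrt (\<Sum>i\<in>UNIV. (Re (v $ i))\<^sup>2 + (Im (v $ i))\<^sup>2)" for v :: "complex ^ 'n"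
    by (simp add: norm_vec_def L2_set_def cmod_power2)
  show ?thesis
    by (simp add: hnorm_def star_vfun_def n star_fun_comp[OF x] sum_nonneg
        flip: star_fun_power2[OF x] star_fun_add[OF x] star_fun_sum[OF x])
qed

text \<open>This turns the componentwise closeness to \<open>L\<close> into a statement about the
  extension of a single real function, to which a real limit criterion applies.\<close>

lemma hmod_hvec_minus_normalized:
  fixes F :: "real \<Rightarrow> complex ^ 'n"
  assumes x: "x \<in> enlarge D"
  defines "u \<equiv> star_vfun star D F x"
  shows "hmod star ((hvec emb L - hdivide u (hnorm star u)) $ i)
    = star_fun star D (\<lambda>t. cmod (L $ i - F t $ i / of_real (norm (F t)))) x"
proof -
  have "(hvec emb L - hdivide u (hnorm star u)) $ i =
      HComplex (star_fun star D (\<lambda>t. Re (L $ i - F t $ i / of_real (norm (F t)))) x)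
        (star_fun star D (\<lambda>t. Im (L $ i - F t $ i / of_real (norm (F t)))) x)"
    unfolding u_def hnorm_star_vfun[OF x]
    by (simp add: minus_hcomplex_def hvec_def hdivide_def star_vfun_def
        star_fun_diff[OF x] star_fun_divide[OF x] star_fun_const[OF x])
  then show ?thesis by (simp only: hmod_star_fun[OF x])
qed

section \<open>From infinitesimal values on the halo to a real limit\<close>

lemma enlarge_greaterThan_0:
  assumes "0 < x"
  shows "x \<in> enlarge {0<..}"
proof -
  \<comment> \<open>Variable 0 stays free and serves as the parameter 0, since
    \<open>emb 0 = 0\<close>.\<close>
  have "sat star (All 1 (Neg (Conj (Holds {[a, b] | a b. a < b} [0, 1])
      (Neg (Holds {[a] | a. a \<in> {0<..}} [1]))))) (\<lambda>_. emb 0)"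
    by (subst transfer[symmetric]) auto
  then show ?thesis using assms by (simp add: star_less emb_0)
qed

text \<open>The assumption concerns points of \<open>enlarge D\<close> only. The real bad points are
  therefore chosen inside \<open>D\<close> as well as near \<open>t0\<close>, which places the
  resulting hyperreal bad point in \<open>enlarge D\<close>.\<close>

lemma infinitesimal_on_hal_imp_tendsto_0:
  assumes D: "open D" "t0 \<in> D" and q: "\<And>t. 0 \<le> q t"
    and inf: "\<And>t. t \<in> enlarge D \<Longrightarrow> t \<in> hal emb t0 - {emb t0} \<Longrightarrow> infinitesimal emb (star_fun star D q t)"
  shows "(q \<longlongrightarrow> 0) (at t0)"
proof (rule ccontr)
  assume "\<not> ?thesis"
  then obtain \<eta> where \<eta>: "\<eta> > 0" and ne: "\<not> (\<forall>\<^sub>F t in at t0. q t < \<eta>)"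
    using q by (auto simp: tendsto_iff)
  have "\<exists>t\<in>D. 0 < \<bar>t - t0\<bar> \<and> \<bar>t - t0\<bar> < \<delta> \<and> \<eta> \<le> q t" if "\<delta> > 0" for \<delta>
  proof -
    have "\<forall>\<^sub>F t in at t0. t \<in> D" using D by (rule eventually_at_in_open')
    moreover have "\<forall>\<^sub>F t in at t0. 0 < \<bar>t - t0\<bar> \<and> \<bar>t - t0\<bar> < \<delta>"
      using that by (auto simp: eventually_at dist_real_def)
    ultimately have "\<forall>\<^sub>F t in at t0. t \<in> D \<and> 0 < \<bar>t - t0\<bar> \<and> \<bar>t - t0\<bar> < \<delta>"
      by (rule eventually_conj)
    moreover have "\<exists>\<^sub>F t in at t0. \<eta> \<le> q t" using ne by (simp add: frequently_def not_le)
    ultimately have "\<exists>\<^sub>F t in at t0. (t \<in> D \<and> 0 < \<bar>t - t0\<bar> \<and> \<bar>t - t0\<bar> < \<delta>) \<and> \<eta> \<le> q t"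
      by (rule frequently_eventually_conj[rotated])
    then show ?thesis by (blast dest: frequently_ex)
  qed
  then obtain \<tau> where \<tau>: "\<And>\<delta>. \<delta> > 0 \<Longrightarrow> \<tau> \<delta> \<in> D"
      "\<And>\<delta>. \<delta> > 0 \<Longrightarrow> 0 < \<bar>\<tau> \<delta> - t0\<bar> \<and> \<bar>\<tau> \<delta> - t0\<bar> < \<delta>" "\<And>\<delta>. \<delta> > 0 \<Longrightarrow> \<eta> \<le> q (\<tau> \<delta>)"
    by metis
  obtain d0 where "d0 \<noteq> 0" "infinitesimal emb d0" using nonzero_infinitesimal by blast
  then have d: "0 < \<bar>d0\<bar>" "infinitesimal emb \<bar>d0\<bar>" by (auto simp: infinitesimal_def)
  \<comment> \<open>The absolute value is taken because \<tau> is controlled only at positive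
    arguments.\<close>
  define d where "d = \<bar>d0\<bar>"
  have E: "d \<in> enlarge {0<..}" using d(1) unfolding d_def by (rule enlarge_greaterThan_0)
  define t where "t = star_fun star {0<..} \<tau> d"
  \<comment> \<open>The bound on the distance is split into two one-sided inequalities, so that only
    sums, differences and the order have to be extended.\<close>
  have 1: "t < emb t0 + d"
    using star_fun_less[OF E, of \<tau> "\<lambda>\<delta>. t0 + \<delta>"] \<tau>(2)
    by (force simp: t_def star_fun_add[OF E] star_fun_const[OF E] star_fun_ident[OF E])
  have 2: "emb t0 - d < t"
    using star_fun_less[OF E, of "\<lambda>\<delta>. t0 - \<delta>" \<tau>] \<tau>(2)
    by (force simp: t_def star_fun_diff[OF E] star_fun_const[OF E] star_fun_ident[OF E])
  \<comment> \<open>A positive square expresses \<open>\<tau> \<delta> \<noteq> t0\<close> as a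
    strict inequality between extendable functions.\<close>
  have "star_fun star {0<..} (\<lambda>_. 0) d < star_fun star {0<..} (\<lambda>\<delta>. (\<tau> \<delta> - t0)\<^sup>2) d"
    using \<tau>(2) by (intro star_fun_less[OF E]) (auto simp: zero_less_power2)
  then have 3: "t \<noteq> emb t0"
    by (auto simp: t_def star_fun_power2[OF E] star_fun_diff[OF E] star_fun_const[OF E] emb_0)
  have "infinitesimal emb (t - emb t0)"
    unfolding infinitesimal_def
  proof (intro allI impI)
    fix r :: real assume "r > 0"
    then have "d < emb r" using d by (auto simp: infinitesimal_def d_def)
    moreover have "\<bar>t - emb t0\<bar> < d" using 1 2 by (auto simp: abs_less_iff algebra_simps)
    ultimately show "\<bar>t - emb t0\<bar> < emb r" by (rule order.strict_trans[rotated])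
  qed
  then have hal: "t \<in> hal emb t0 - {emb t0}" using 3 by (simp add: hal_def)
  have tD: "t \<in> enlarge D"
    using star_fun_rel[OF E, of "[\<tau>]" "{[a] | a. a \<in> D}"] \<tau>(1) by (simp add: t_def)
  \<comment> \<open>Halving \<eta> makes the bound \<open>\<eta> \<le> q (\<tau> \<delta>)\<close>
    strict, as \<open>star_fun_less\<close> requires.\<close>
  have "emb (\<eta> / 2) < star_fun star {0<..} (\<lambda>\<delta>. q (\<tau> \<delta>)) d"
    using star_fun_less[OF E, of "\<lambda>_. \<eta> / 2" "\<lambda>\<delta>. q (\<tau> \<delta>)"] \<tau>(3) \<eta>
    by (force simp: star_fun_const[OF E])
  also have "\<dots> = star_fun star D q t"
    using star_fun_comp[OF E, of \<tau> D q] \<tau>(1) by (simp add: t_def)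
  also have "\<dots> < emb (\<eta> / 2)"
    using inf[OF tD hal] \<eta> by (auto simp: infinitesimal_def abs_less_iff)
  finally show False .
qed

end

section \<open>Continuity into projective space and the continuation\<close>

lemma proj_class_scale:
  assumes "c \<noteq> 0"
  shows "proj_class (c *s x) = proj_class x"
proof -
  have "\<exists>b. a *s x = b *s (c *s x) \<and> b \<noteq> 0" if "a \<noteq> 0" for a
    using assms that by (intro exI[of _ "a / c"]) (simp add: vector_smult_assoc)
  then show ?thesis
    using assms unfolding proj_class_def by (auto simp: vector_smult_assoc)
qed

text \<open>By the quotient topology, the preimage of an open \<open>U\<close> is the
  \<Theta>-preimage of the open cone over \<open>U\<close>. As \<Theta> avoids 0 on
  \<open>S\<close>, excluding 0 from the cone loses no point.\<close>

lemma continuous_map_proj_class: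
  fixes \<Theta> :: "'a::topological_space \<Rightarrow> complex ^ 'n"
  assumes cont: "continuous_on S \<Theta>" and nz: "\<And>t. t \<in> S \<Longrightarrow> \<Theta> t \<noteq> 0"
  shows "continuous_map (top_of_set S) CP_topology (\<lambda>t. proj_class (\<Theta> t))"
proof -
  \<comment> \<open>The set of all classes is itself open, because the non-zero vectors form an open
    set; this identifies \<open>topspace\<close>.\<close>
  have "openin CP_topology (proj_class ` (- {0 :: complex ^ 'n}))"
  proof -
    have "{x :: complex ^ 'n. x \<noteq> 0 \<and> proj_class x \<in> proj_class ` (- {0})} = - {0}" by auto
    moreover have "open (- {0 :: complex ^ 'n})" by (simp add: open_Compl)
    ultimately show ?thesis unfolding openin_CP_topology by (simp only: subset_refl simp_thms)
  qed
  then have space: "topspace CP_topology = proj_class ` (- {0 :: complex ^ 'n})"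
    using openin_topspace[of "CP_topology :: (complex ^ 'n) set topology", unfolded openin_CP_topology,
      THEN conjunct1] by (intro subset_antisym openin_subset)
  show ?thesis
    unfolding continuous_map space topspace_euclidean_subtopology
  proof (intro conjI allI impI)
    show "(\<lambda>t. proj_class (\<Theta> t)) ` S \<subseteq> proj_class ` (- {0})" using nz by auto
    fix U :: "(complex ^ 'n) set set" assume U: "openin CP_topology U"
    have "{t \<in> S. proj_class (\<Theta> t) \<in> U} = S \<inter> \<Theta> -` {x. x \<noteq> 0 \<and> proj_class x \<in> U}"
      using nz by auto
    then show "openin (top_of_set S) {t \<in> S. proj_class (\<Theta> t) \<in> U}"
      using continuous_openin_preimage_gen[OF cont U[unfolded openin_CP_topology, THEN conjunct2]]
      by (simp only:)
  qed
qed

lemma C0_continuation_of_normalized_limit: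
  fixes \<Psi> :: "real \<Rightarrow> complex ^ 'n"
  assumes D: "open D" "t0 \<in> D" and cont: "continuous_on D \<Psi>" and "L \<noteq> 0"
    and lim: "((\<lambda>t. inverse (norm (\<Psi> t)) *\<^sub>R \<Psi> t) \<longlongrightarrow> L) (at t0)"
  shows "\<exists>\<epsilon>>0. ball t0 \<epsilon> \<subseteq> D \<and>
    (\<exists>\<Theta> :: real \<Rightarrow> complex ^ 'n.
       continuous_on (ball t0 \<epsilon>) \<Theta> \<and> (\<forall>t \<in> ball t0 \<epsilon>. \<Theta> t \<noteq> 0) \<and>
       (\<forall>t \<in> ball t0 \<epsilon> - {t0}. \<Psi> t \<noteq> 0 \<and> proj_class (\<Psi> t) = proj_class (\<Theta> t)) \<and>
       C0_continuation (ball t0 \<epsilon>) (\<lambda>t. proj_class (\<Theta> t)) (\<lambda>t. proj_class (\<Psi> t)) t0)"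
proof -
  \<comment> \<open>The normalised vector is 0 wherever \<Psi> vanishes, so a non-zero limit
    excludes zeros of \<Psi> in a punctured neighbourhood of \<open>t0\<close>.\<close>
  have "\<forall>\<^sub>F t in at t0. inverse (norm (\<Psi> t)) *\<^sub>R \<Psi> t \<noteq> 0"
    using lim \<open>L \<noteq> 0\<close> by (rule tendsto_imp_eventually_ne)
  then obtain \<epsilon>1 where \<epsilon>1: "\<epsilon>1 > 0" "\<And>t. t \<noteq> t0 \<Longrightarrow> dist t t0 < \<epsilon>1 \<Longrightarrow> \<Psi> t \<noteq> 0"
    by (auto simp: eventually_at)
  obtain \<epsilon>2 where \<epsilon>2: "\<epsilon>2 > 0" "ball t0 \<epsilon>2 \<subseteq> D" using D by (meson open_contains_ball)
  \<comment> \<open>The first radius keeps \<Psi> non-zero away from \<open>t0\<close>, the second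
    keeps the ball inside \<open>D\<close>.\<close>
  define \<epsilon> where "\<epsilon> = min \<epsilon>1 \<epsilon>2"
  define B where "B = ball t0 \<epsilon>"
  define \<Theta> where "\<Theta> = (\<lambda>t. if t = t0 then L else inverse (norm (\<Psi> t)) *\<^sub>R \<Psi> t)"
  have "\<epsilon> > 0" using \<epsilon>1 \<epsilon>2 by (simp add: \<epsilon>_def)
  have "B \<subseteq> D" using \<epsilon>2 by (auto simp: B_def \<epsilon>_def)
  have \<Psi>0: "\<Psi> t \<noteq> 0" if "t \<in> B - {t0}" for t
    using that \<epsilon>1(2)[of t] by (auto simp: B_def \<epsilon>_def dist_commute)
  have cont\<Theta>: "continuous_on B \<Theta>"
    unfolding continuous_on_def
  proof
    fix t assume t: "t \<in> B"
    show "(\<Theta> \<longlongrightarrow> \<Theta> t) (at t within B)"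
    \<comment> \<open>At \<open>t0\<close> continuity of \<Theta> is the assumed limit. Elsewhere
      \<open>\<Psi> t\<close> is non-zero, so the normalisation is continuous at \<open>t\<close>,
      and it agrees with \<Theta> near \<open>t\<close>.\<close>
    proof (cases "t = t0")
      case True
      have "(\<Theta> \<longlongrightarrow> L) (at t0)"
        using lim by (rule Lim_transform_eventually) (auto simp: eventually_at \<Theta>_def intro: exI[of _ 1])
      then show ?thesis using True by (auto simp: \<Theta>_def intro: tendsto_within_subset)
    next
      case False
      have "isCont \<Psi> t"
        using cont t \<open>B \<subseteq> D\<close> D(1) by (auto simp: continuous_on_eq_continuous_at)
      then have "((\<lambda>t. inverse (norm (\<Psi> t)) *\<^sub>R \<Psi> t) \<longlongrightarrow> inverse (norm (\<Psi> t)) *\<^sub>R \<Psi> t) (at t)"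
        using \<Psi>0[of t] t False by (auto simp: isCont_def intro!: tendsto_intros)
      moreover have "\<forall>\<^sub>F s in at t. inverse (norm (\<Psi> s)) *\<^sub>R \<Psi> s = \<Theta> s"
        using eventually_neq_at_within[of t0 t] by eventually_elim (simp add: \<Theta>_def)
      ultimately have "(\<Theta> \<longlongrightarrow> inverse (norm (\<Psi> t)) *\<^sub>R \<Psi> t) (at t)"
        by (rule Lim_transform_eventually)
      then show ?thesis using False by (auto simp: \<Theta>_def intro: tendsto_within_subset)
    qed
  qed
  have \<Theta>0: "\<Theta> t \<noteq> 0" if "t \<in> B" for t using \<Psi>0[of t] that \<open>L \<noteq> 0\<close> by (auto simp: \<Theta>_def)
  have cls: "proj_class (\<Psi> t) = proj_class (\<Theta> t)" if "t \<in> B - {t0}" for t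
  proof -
    \<comment> \<open>The real factor is rewritten as a complex scalar, the kind of multiple that
      \<open>proj_class\<close> identifies.\<close>
    have "\<Theta> t = complex_of_real (inverse (norm (\<Psi> t))) *s \<Psi> t"
      using that by (simp add: \<Theta>_def vec_eq_iff scaleR_conv_of_real[where 'a = complex])
    then show ?thesis using \<Psi>0[OF that] by (simp add: proj_class_scale)
  qed
  have "open B" "t0 \<in> B" using \<open>\<epsilon> > 0\<close> by (auto simp: B_def)
  then have "\<forall>\<^sub>F t in at t0. t \<in> B - {t0}" by (rule eventually_at_in_open)
  then have "\<forall>\<^sub>F t in at t0. proj_class (\<Psi> t) = proj_class (\<Theta> t)"
    by (rule eventually_mono) (rule cls)
  then have "C0_continuation B (\<lambda>t. proj_class (\<Theta> t)) (\<lambda>t. proj_class (\<Psi> t)) t0"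
    using \<open>open B\<close> \<open>t0 \<in> B\<close> continuous_map_proj_class[OF cont\<Theta> \<Theta>0] by (simp add: C0_continuation_def)
  with \<open>\<epsilon> > 0\<close> \<open>B \<subseteq> D\<close> cont\<Theta> \<Theta>0 \<Psi>0 cls show ?thesis
    unfolding B_def by (intro exI[of _ \<epsilon>] exI[of _ \<Theta>] conjI ballI) auto
qed

theorem theorem82:
  fixes emb :: "real \<Rightarrow> 'h::linordered_field"
    and star :: "real list set \<Rightarrow> 'h list set"
    and \<Psi> :: "real \<Rightarrow> complex ^ 'n"
    and t0 :: real
  assumes "nonstandard_extension emb star"
    and "continuous_on {0<..<1} \<Psi>"
    and "t0 \<in> {0<..<1}"
    and "\<forall>t \<in> hal emb t0 - {emb t0}. star_vfun star {0<..<1} \<Psi> t \<noteq> 0"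
    and "\<exists>L :: complex ^ 'n. L \<noteq> 0 \<and>
      (\<forall>\<Delta>t \<Delta>t'. infinitesimal emb \<Delta>t \<and> \<Delta>t \<noteq> 0 \<and> infinitesimal emb \<Delta>t' \<and> \<Delta>t' \<noteq> 0 \<longrightarrow>
        (let u = star_vfun star {0<..<1} \<Psi> (emb t0 + \<Delta>t);
             u' = star_vfun star {0<..<1} \<Psi> (emb t0 + \<Delta>t')
         in infinitely_close emb star (hvec emb L) (hdivide u (hnorm star u)) \<and>
            infinitely_close emb star (hdivide u (hnorm star u)) (hdivide u' (hnorm star u'))))"
  shows "\<exists>\<epsilon>>0. ball t0 \<epsilon> \<subseteq> {0<..<1} \<and>
    (\<exists>\<Theta> :: real \<Rightarrow> complex ^ 'n.
       continuous_on (ball t0 \<epsilon>) \<Theta> \<and> (\<forall>t \<in> ball t0 \<epsilon>. \<Theta> t \<noteq> 0) \<and>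
       (\<forall>t \<in> ball t0 \<epsilon> - {t0}. \<Psi> t \<noteq> 0 \<and> proj_class (\<Psi> t) = proj_class (\<Theta> t)) \<and>
       C0_continuation (ball t0 \<epsilon>) (\<lambda>t. proj_class (\<Theta> t)) (\<lambda>t. proj_class (\<Psi> t)) t0)"
proof -
  interpret nonstandard_extension emb star by fact
  let ?D = "{0<..<1 :: real}"
  from assms(5) obtain L :: "complex ^ 'n" where "L \<noteq> 0"
    and L: "\<And>\<Delta>t. infinitesimal emb \<Delta>t \<Longrightarrow> \<Delta>t \<noteq> 0 \<Longrightarrow>
      (let u = star_vfun star ?D \<Psi> (emb t0 + \<Delta>t)
       in infinitely_close emb star (hvec emb L) (hdivide u (hnorm star u)))"
    unfolding Let_def by metis
  have "((\<lambda>t. inverse (norm (\<Psi> t)) *\<^sub>R \<Psi> t) \<longlongrightarrow> L) (at t0)"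
  \<comment> \<open>Both \<open>infinitely_close\<close> and convergence in a finite-dimensional
    space are tested component by component.\<close>
  proof (rule vec_tendstoI)
    fix i
    have "((\<lambda>t. cmod (L $ i - \<Psi> t $ i / of_real (norm (\<Psi> t)))) \<longlongrightarrow> 0) (at t0)"
    proof (rule infinitesimal_on_hal_imp_tendsto_0[of ?D])
      fix t assume t: "t \<in> enlarge ?D" "t \<in> hal emb t0 - {emb t0}"
      \<comment> \<open>A halo point \<open>t\<close> corresponds to the increment
        \<open>t - emb t0\<close>, at which the closeness to \<open>L\<close> is read off.\<close>
      then have "infinitesimal emb (t - emb t0)" "t - emb t0 \<noteq> 0" by (auto simp: hal_def)
      from L[OF this] have "infinitely_close emb star (hvec emb L)
          (hdivide (star_vfun star ?D \<Psi> t) (hnorm star (star_vfun star ?D \<Psi> t)))"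
        by (simp add: Let_def)
      then show "infinitesimal emb
          (star_fun star ?D (\<lambda>t. cmod (L $ i - \<Psi> t $ i / of_real (norm (\<Psi> t)))) t)"
        unfolding infinitely_close_def hmod_hvec_minus_normalized[OF t(1)] by (rule spec)
    qed (use assms(3) in auto)
    then have "((\<lambda>t. \<Psi> t $ i / of_real (norm (\<Psi> t))) \<longlongrightarrow> L $ i) (at t0)"
      by (simp add: tendsto_iff dist_norm norm_minus_commute)
    then show "((\<lambda>t. (inverse (norm (\<Psi> t)) *\<^sub>R \<Psi> t) $ i) \<longlongrightarrow> L $ i) (at t0)"
      by (simp add: scaleR_conv_of_real[where 'a = complex] divide_inverse mult.commute)
  qed
  with assms(2,3) \<open>L \<noteq> 0\<close> show ?thesis
    by (intro C0_continuation_of_normalized_limit) auto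
qed

end
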